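(* Let $(t_n)_{n\ge0}$ be the Takeuchi numbers, let $C_n=\frac{1}{n+1}\binom{2n}{n}$ be the Catalan numbers, and let $\mathbf{E}=(E(n,k))_{n,k\ge0}$ be the eigentriangle of the Catalan matrix $(c(x),xc(x))$. Then the sequence of Takeuchi numbers is the image under $\mathbf{E}$ of the sequence with generating function $\frac{c(x)-1}{1-x}$, whose general term is $\sum_{j=0}^{n-1}C_{j+1}$; that is, for all $n\ge0$, $$t_n=\sum_{k=0}^nE(n,k)\sum_{j=0}^{k-1}C_{j+1}.$$ Moreover, if the numbers $\tilde E(n,j)$ ($n,j\ge0$) are defined recursively by $\tilde E(0,j)=1$ and, for $n\ge1$, $$\tilde E(n,j)=\sum_{k=0}^{n-1}\binom{2(n-1)+j-k}{n-1-k}\frac{k+j+1}{n+j}\,\tilde E(k,j),$$ then for all $n\ge0$ $$t_n=\sum_{k=0}^n\tilde E(n-k,k)\sum_{j=0}^{k-1}C_{j+1}.$$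
   Context: $c(x)=\frac{1-\sqrt{1-4x}}{2x}=\sum_{n\ge0}C_nx^n$ is the generating function of the Catalan numbers. The Takeuchi numbers $t_n$ (OEIS A000651, beginning $0,1,4,14,53,\dots$) have generating function $T(x)=\sum_{n\ge0}t_nx^n$, which is taken here to be the formal power series determined by the (known) functional equation $$T(x)=\frac{c(x)-1}{1-x}+\frac{x(2-c(x))}{\sqrt{1-4x}}\,T(xc(x)).$$ The Catalan matrix $(c(x),xc(x))$ is the Riordan array, i.e. the infinite lower-triangular matrix, whose $k$-th column ($k=0,1,2,\dots$) has generating function $c(x)(xc(x))^k$; rows and columns are indexed from $0$. For an infinite lower-triangular matrix $A=(A(n,k))_{n,k\ge0}$ with $1$'s on the diagonal, its eigentriangle is the inverse of the lower-triangular matrix whose $(n,k)$ entry is $1$ if $n=k$, $-A(n-1,k)$ if $n\ge k+1$, and $0$ if $n<k$. Empty sums are $0$. *)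

theory Defs
  imports Complex_Main "HOL-Computational_Algebra.Formal_Power_Series"
begin

unbundle fps_syntax

definition catalan :: "nat \<Rightarrow> real" where
  "catalan n = real ((2 * n) choose n) / real (n + 1)"

definition catalan_gf :: "real fps" where
  "catalan_gf = Abs_fps catalan"

definition fps_sqrt_1_4X :: "real fps" where
  "fps_sqrt_1_4X = fps_radical root 2 (1 - 4 * fps_X)"

lemma catalan_0: "catalan 0 = 1"
  by (simp add: catalan_def)

lemma catalan_Suc: "(real n + 2) * catalan (Suc n) = (4 * real n + 2) * catalan n"
proof -
  have "Suc n * ((2 * Suc n) choose Suc n) = (2 * Suc n) * (Suc (2 * n) choose n)"
    using Suc_times_binomial_eq[of "Suc (2*n)" n] by (simp add: mult.commute)
  hence "Suc n * ((2 * Suc n) choose Suc n) = Suc n * (2 * (Suc (2 * n) choose n))"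
    by (simp add: algebra_simps)
  hence A: "(2 * Suc n) choose Suc n = 2 * (Suc (2 * n) choose n)"
    by (metis Suc_mult_cancel1)
  have "(Suc (2 * n) choose n) = (Suc (2 * n) choose Suc n)"
    using binomial_symmetric[of n "Suc (2*n)"] by simp
  moreover have "Suc n * (Suc (2 * n) choose Suc n) = Suc (2 * n) * (2 * n choose n)"
    using Suc_times_binomial_eq[of "2*n" n] by (simp add: mult.commute)
  ultimately have "Suc n * (Suc (2 * n) choose n) = Suc (2 * n) * (2 * n choose n)" by metis
  hence B: "real (Suc n * (Suc (2 * n) choose n)) = real (Suc (2 * n) * (2 * n choose n))" by (simp only:)
  have "(real n + 2) * catalan (Suc n) = real ((2 * Suc n) choose Suc n)"
    by (simp add: catalan_def field_simps del: binomial_Suc_Suc mult_Suc_right)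
  also have "\<dots> = 2 * real (Suc (2 * n) choose n)"
    by (simp add: A del: binomial_Suc_Suc mult_Suc_right)
  also have "\<dots> = 2 * (real (2 * n + 1) * real (2 * n choose n) / real (n + 1))"
    using B by (simp add: field_simps)
  also have "\<dots> = (4 * real n + 2) * catalan n"
    by (simp add: catalan_def field_simps)
  finally show ?thesis .
qed

lemma sqrt_1_4X_eq: "1 - 2 * fps_X * catalan_gf = fps_sqrt_1_4X"
proof -
  define D where "D = 1 - fps_X * (fps_const 2 * catalan_gf)"
  have D0: "D $ 0 = 1" by (simp add: D_def)
  have DS: "D $ Suc n = - 2 * catalan n" for n
    by (simp add: D_def catalan_gf_def)
  have rec: "real (Suc n) * D $ Suc n - 4 * real n * D $ n = - 2 * D $ n" for n
  proof (cases n)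
    case 0 thus ?thesis by (simp add: D0 DS catalan_0)
  next
    case (Suc m) thus ?thesis using catalan_Suc[of m] by (simp add: DS algebra_simps)
  qed
  have ode: "(1 - fps_const 4 * fps_X) * fps_deriv D = - (fps_const 2 * D)"
  proof (rule fps_ext)
    fix n
    show "((1 - fps_const 4 * fps_X) * fps_deriv D) $ n = (- (fps_const 2 * D)) $ n"
      using rec[of n] by (cases n) (simp_all add: algebra_simps mult.assoc)
  qed
  define Q where "Q = D ^ 2"
  have odeQ: "(1 - fps_const 4 * fps_X) * fps_deriv Q = - (fps_const 4 * Q)"
  proof -
    have "fps_deriv Q = fps_const 2 * D * fps_deriv D"
      by (simp add: Q_def power2_eq_square fps_const_add[symmetric] algebra_simps
          flip: numeral_fps_const)
    hence "(1 - fps_const 4 * fps_X) * fps_deriv Q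
        = fps_const 2 * D * ((1 - fps_const 4 * fps_X) * fps_deriv D)"
      by (simp add: ac_simps)
    also have "\<dots> = - (fps_const 4 * Q)"
      unfolding ode Q_def by (simp add: power2_eq_square algebra_simps flip: numeral_fps_const)
    finally show ?thesis .
  qed
  have recQ: "real (Suc n) * Q $ Suc n = 4 * (real n - 1) * Q $ n" for n
    using arg_cong[OF odeQ, of "\<lambda>f. f $ n"]
    by (cases n) (simp_all add: algebra_simps mult.assoc)
  have Q0: "Q $ 0 = 1" by (simp add: Q_def D0 power2_eq_square)
  have Q1: "Q $ Suc 0 = - 4" using recQ[of 0] Q0 by simp
  have Q2: "Q $ Suc (Suc n) = 0" for n
  proof (induction n)
    case 0 show ?case using recQ[of 1] by simp
  next
    case (Suc n) show ?case using recQ[of "Suc (Suc n)"] Suc by simp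
  qed
  have "Q = 1 - fps_const 4 * fps_X"
  proof (rule fps_ext)
    fix n show "Q $ n = (1 - fps_const 4 * fps_X) $ n"
      by (cases n rule: nat.exhaust[case_product nat.exhaust, of _ "n - 1"])
         (auto simp: Q0 Q1 Q2 fps_X_def)
  qed
  hence "D ^ Suc 1 = 1 - 4 * fps_X"
    by (simp add: Q_def power2_eq_square numeral_fps_const)
  hence "D = fps_radical root (Suc 1) (1 - 4 * fps_X)"
    by (subst (asm) radical_unique[where r = root]) (simp_all add: D0)
  moreover have "D = 1 - 2 * fps_X * catalan_gf"
    by (simp add: D_def numeral_fps_const ac_simps)
  ultimately show ?thesis by (simp add: fps_sqrt_1_4X_def numeral_2_eq_2)
qed

lemma catalan_gf_closed_form: "catalan_gf = (1 - fps_sqrt_1_4X) / (2 * fps_X)"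
proof -
  have "1 - fps_sqrt_1_4X = catalan_gf * (2 * fps_X)"
    by (simp add: sqrt_1_4X_eq[symmetric] ac_simps)
  thus ?thesis by simp
qed

definition takeuchi_equation :: "real fps \<Rightarrow> bool" where
  "takeuchi_equation T \<longleftrightarrow>
     T = (catalan_gf - 1) / (1 - fps_X)
       + fps_X * (2 - catalan_gf) / fps_sqrt_1_4X * (T oo (fps_X * catalan_gf))"

definition takeuchi_gf :: "real fps" where
  "takeuchi_gf = (THE T. takeuchi_equation T)"

definition takeuchi :: "nat \<Rightarrow> real" where
  "takeuchi n = fps_nth takeuchi_gf n"

function fps_fix_coeff :: "real fps \<Rightarrow> real fps \<Rightarrow> real fps \<Rightarrow> nat \<Rightarrow> real" where
  "fps_fix_coeff g h f n =
     g $ n + (\<Sum>i<n. h $ (n - 1 - i) * (\<Sum>k<Suc i. (if k < n then fps_fix_coeff g h f k else 0) * (f ^ k) $ i))"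
  by pat_completeness auto
termination by (relation "measure (\<lambda>(g, h, f, n). n)") auto
declare fps_fix_coeff.simps [simp del]

lemma fps_fix_nth:
  "(g + fps_X * h * (T oo f)) $ n
     = g $ n + (\<Sum>i<n. h $ (n - 1 - i) * (\<Sum>k<Suc i. T $ k * (f ^ k) $ i))"
  for g h f T :: "real fps"
proof (cases n)
  case (Suc m)
  have "(fps_X * h * (T oo f)) $ n = ((T oo f) * h) $ m"
    unfolding mult.commute[of "T oo f" h] by (simp add: Suc mult.assoc)
  also have "\<dots> = (\<Sum>i<n. h $ (n - 1 - i) * (\<Sum>k<Suc i. T $ k * (f ^ k) $ i))"
    by (subst fps_mult_nth)
       (simp add: Suc fps_compose_nth atLeast0AtMost lessThan_Suc_atMost mult.commute
         del: sum.lessThan_Suc sum.atMost_Suc)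
  finally show ?thesis by simp
qed (simp add: mult.assoc)

lemma fps_fix_ex1: "\<exists>!T. T = g + fps_X * h * (T oo f)" for g h f :: "real fps"
proof (rule ex_ex1I)
  define T where "T = Abs_fps (fps_fix_coeff g h f)"
  show "\<exists>T. T = g + fps_X * h * (T oo f)"
  proof (intro exI[of _ T] fps_ext)
    fix n
    show "T $ n = (g + fps_X * h * (T oo f)) $ n"
      unfolding fps_fix_nth
      using fps_fix_coeff.simps[of g h f n]
      by (auto simp: T_def simp del: sum.lessThan_Suc intro!: sum.cong arg_cong2[where f = "(*)"])
  qed
next
  fix T U :: "real fps"
  assume T: "T = g + fps_X * h * (T oo f)" and U: "U = g + fps_X * h * (U oo f)"
  show "T = U"
  proof (rule fps_ext)
    fix n show "T $ n = U $ n"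
    proof (induction n rule: less_induct)
      case (less n)
      have "T $ n = g $ n + (\<Sum>i<n. h $ (n - 1 - i) * (\<Sum>k<Suc i. T $ k * (f ^ k) $ i))"
        using fps_fix_nth[of g h T f n] T by simp
      also have "\<dots> = g $ n + (\<Sum>i<n. h $ (n - 1 - i) * (\<Sum>k<Suc i. U $ k * (f ^ k) $ i))"
        by (intro arg_cong2[where f = "(+)"] sum.cong refl arg_cong2[where f = "(*)"] less) auto
      also have "\<dots> = U $ n"
        using fps_fix_nth[of g h U f n] U by simp
      finally show ?case .
    qed
  qed
qed

lemma takeuchi_equation_ex1: "\<exists>!T. takeuchi_equation T"
proof -
  have "fps_sqrt_1_4X $ 0 = 1" by (simp add: sqrt_1_4X_eq[symmetric] mult.assoc)
  hence "fps_X * (2 - catalan_gf) / fps_sqrt_1_4X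
      = fps_X * ((2 - catalan_gf) / fps_sqrt_1_4X)"
    by (simp add: fps_divide_unit mult.assoc)
  thus ?thesis
    using fps_fix_ex1 by (simp add: takeuchi_equation_def)
qed

lemma takeuchi_equation_takeuchi_gf: "takeuchi_equation takeuchi_gf"
  unfolding takeuchi_gf_def by (rule theI') (rule takeuchi_equation_ex1)

definition lower_triangular :: "(nat \<Rightarrow> nat \<Rightarrow> real) \<Rightarrow> bool" where
  "lower_triangular A \<longleftrightarrow> (\<forall>n k. n < k \<longrightarrow> A n k = 0)"

text \<open>Truncating the sum at the row index gives the usual product when \<open>A\<close> is lower triangular.\<close>
definition lt_mult :: "(nat \<Rightarrow> nat \<Rightarrow> real) \<Rightarrow> (nat \<Rightarrow> nat \<Rightarrow> real) \<Rightarrow> nat \<Rightarrow> nat \<Rightarrow> real" where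
  "lt_mult A B n k = (\<Sum>i\<le>n. A n i * B i k)"

definition lt_one :: "nat \<Rightarrow> nat \<Rightarrow> real" where
  "lt_one n k = (if n = k then 1 else 0)"

definition lt_apply :: "(nat \<Rightarrow> nat \<Rightarrow> real) \<Rightarrow> (nat \<Rightarrow> real) \<Rightarrow> nat \<Rightarrow> real" where
  "lt_apply A s n = (\<Sum>k\<le>n. A n k * s k)"

definition lt_is_inverse :: "(nat \<Rightarrow> nat \<Rightarrow> real) \<Rightarrow> (nat \<Rightarrow> nat \<Rightarrow> real) \<Rightarrow> bool" where
  "lt_is_inverse A B \<longleftrightarrow> lower_triangular B \<and> lt_mult A B = lt_one \<and> lt_mult B A = lt_one"

definition lt_inverse :: "(nat \<Rightarrow> nat \<Rightarrow> real) \<Rightarrow> nat \<Rightarrow> nat \<Rightarrow> real" where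
  "lt_inverse A = (THE B. lt_is_inverse A B)"

lemma lt_mult_assoc:
  assumes "lower_triangular B"
  shows "lt_mult (lt_mult A B) C = lt_mult A (lt_mult B C)"
proof (intro ext)
  fix n k
  have "lt_mult (lt_mult A B) C n k = (\<Sum>j\<le>n. \<Sum>i\<le>n. A n j * (B j i * C i k))"
    by (subst sum.swap) (simp add: lt_mult_def sum_distrib_right mult.assoc)
  also have "\<dots> = (\<Sum>j\<le>n. \<Sum>i\<le>j. A n j * (B j i * C i k))"
    using assms by (intro sum.cong refl sum.mono_neutral_right) (auto simp: lower_triangular_def)
  also have "\<dots> = lt_mult A (lt_mult B C) n k"
    by (simp add: lt_mult_def sum_distrib_left)
  finally show "lt_mult (lt_mult A B) C n k = lt_mult A (lt_mult B C) n k" .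
qed

lemma lt_mult_one_left: "lt_mult lt_one A = A"
proof (intro ext)
  fix n k
  have "lt_mult lt_one A n k = (\<Sum>i\<le>n. if n = i then A i k else 0)"
    unfolding lt_mult_def lt_one_def by (intro sum.cong) auto
  thus "lt_mult lt_one A n k = A n k" by simp
qed

lemma lt_mult_one_right:
  assumes "lower_triangular A"
  shows "lt_mult A lt_one = A"
proof (intro ext)
  fix n k
  have "lt_mult A lt_one n k = (\<Sum>i\<le>n. if i = k then A n i else 0)"
    unfolding lt_mult_def lt_one_def by (intro sum.cong) auto
  thus "lt_mult A lt_one n k = A n k" using assms by (simp add: lower_triangular_def)
qed

function lt_right_inverse :: "(nat \<Rightarrow> nat \<Rightarrow> real) \<Rightarrow> nat \<Rightarrow> nat \<Rightarrow> real" where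
  "lt_right_inverse A n k = lt_one n k - (\<Sum>i<n. A n i * lt_right_inverse A i k)"
  by pat_completeness auto
termination by (relation "measure (\<lambda>(A, n, k). n)") auto
declare lt_right_inverse.simps [simp del]

lemma lt_right_inverse:
  assumes "\<And>n. A n n = 1"
  shows "lower_triangular (lt_right_inverse A)" "lt_right_inverse A n n = 1"
    "lt_mult A (lt_right_inverse A) = lt_one"
proof -
  have 0: "n < k \<longrightarrow> lt_right_inverse A n k = 0" for n k
    by (induction n rule: less_induct) (subst lt_right_inverse.simps, auto simp: lt_one_def)
  show "lower_triangular (lt_right_inverse A)" using 0 by (auto simp: lower_triangular_def)
  show "lt_right_inverse A n n = 1"
    by (subst lt_right_inverse.simps) (simp add: 0 lt_one_def)
  show "lt_mult A (lt_right_inverse A) = lt_one"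
  proof (intro ext)
    fix n k
    show "lt_mult A (lt_right_inverse A) n k = lt_one n k"
      using lt_right_inverse.simps[of A n k]
      by (simp add: lt_mult_def assms flip: lessThan_Suc_atMost)
  qed
qed

lemma lt_inverse_ex1:
  assumes "lower_triangular A" "\<And>n. A n n = 1"
  shows "\<exists>!B. lt_is_inverse A B"
proof (rule ex_ex1I)
  define B where "B = lt_right_inverse A"
  define D where "D = lt_right_inverse B"
  have B: "lower_triangular B" "\<And>n. B n n = 1" "lt_mult A B = lt_one"
    unfolding B_def by (intro lt_right_inverse assms(2))+
  have D: "lt_mult B D = lt_one"
    unfolding D_def by (intro lt_right_inverse B(2))
  have "A = lt_mult A (lt_mult B D)" by (simp add: D lt_mult_one_right assms)
  also have "\<dots> = D" by (simp add: lt_mult_assoc[OF B(1), symmetric] B(3) lt_mult_one_left)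
  finally show "\<exists>B. lt_is_inverse A B"
    using B D by (auto simp: lt_is_inverse_def)
next
  fix B C
  assume B: "lt_is_inverse A B" and C: "lt_is_inverse A C"
  have "B = lt_mult B (lt_mult A C)" using B C by (simp add: lt_is_inverse_def lt_mult_one_right)
  also have "\<dots> = C"
    using B by (simp add: lt_mult_assoc[OF assms(1), symmetric] lt_is_inverse_def lt_mult_one_left)
  finally show "B = C" .
qed

definition riordan :: "real fps \<Rightarrow> real fps \<Rightarrow> nat \<Rightarrow> nat \<Rightarrow> real" where
  "riordan g f n k = fps_nth (g * f ^ k) n"

definition catalan_matrix :: "nat \<Rightarrow> nat \<Rightarrow> real" where
  "catalan_matrix = riordan catalan_gf (fps_X * catalan_gf)"

definition eigen_matrix :: "(nat \<Rightarrow> nat \<Rightarrow> real) \<Rightarrow> nat \<Rightarrow> nat \<Rightarrow> real" where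
  "eigen_matrix A n k = (if n = k then 1 else if n \<ge> k + 1 then - A (n - 1) k else 0)"

definition eigentriangle :: "(nat \<Rightarrow> nat \<Rightarrow> real) \<Rightarrow> nat \<Rightarrow> nat \<Rightarrow> real" where
  "eigentriangle A = lt_inverse (eigen_matrix A)"

lemma lt_is_inverse_eigentriangle: "lt_is_inverse (eigen_matrix A) (eigentriangle A)"
  unfolding eigentriangle_def lt_inverse_def
  by (rule theI'[where P = "lt_is_inverse (eigen_matrix A)"], rule lt_inverse_ex1)
     (auto simp: eigen_matrix_def lower_triangular_def)

lemma catalan_matrix_nth:
  "catalan_matrix n k = (if n < k then 0 else (catalan_gf ^ Suc k) $ (n - k))"
proof -
  have "catalan_gf * (fps_X * catalan_gf) ^ k = fps_X ^ k * catalan_gf ^ Suc k"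
    by (simp add: power_mult_distrib ac_simps)
  thus ?thesis by (simp add: catalan_matrix_def riordan_def fps_X_power_mult_nth del: power_Suc)
qed

lemma catalan_matrix_lower_triangular: "lower_triangular catalan_matrix"
  by (simp add: lower_triangular_def catalan_matrix_nth)

lemma catalan_matrix_diag: "catalan_matrix n n = 1"
  by (simp add: catalan_matrix_nth fps_power_zeroth catalan_gf_def catalan_0 del: power_Suc)

function eigen_tilde :: "nat \<Rightarrow> nat \<Rightarrow> real" where
  "eigen_tilde n j =
     (if n = 0 then 1
      else (\<Sum>k<n. real ((2 * (n - 1) + j - k) choose (n - 1 - k))
                    * (real (k + j + 1) / real (n + j)) * eigen_tilde k j))"
  by pat_completeness auto
termination by (relation "measure fst") auto
declare eigen_tilde.simps [simp del]

end

theory Submission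
  imports Defs
begin

text \<open>
  Since \<open>c = 1 + x c\<^sup>2\<close>, one has \<open>c \<sqrt>(1 - 4x) = c - 2x c\<^sup>2 = 2 - c\<close>, so the functional equation
  of the Takeuchi series is \<open>T(x) = g(x) + x c(x) T(x c(x))\<close> with \<open>g = (c - 1) / (1 - x)\<close>. As
  \<open>c(x) T(x c(x))\<close> is the image of \<open>T\<close> under the Catalan matrix, this says that the matrix whose
  inverse is the eigentriangle maps \<open>(t\<^sub>n)\<close> to the coefficients of \<open>g\<close>. The recursion for
  \<open>eigen_tilde m j = E(m + j, j)\<close> is the same inverse relation, with the closed form of the Catalan matrix
  entries \<open>[x\<^sup>m] c\<^sup>k\<^sup>+\<^sup>1\<close> inserted.
\<close>

lemma fps_sqrt_1_4X_square: "fps_sqrt_1_4X ^ 2 = 1 - 4 * fps_X"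
  using power_radical[of "1 - 4 * fps_X :: real fps" root 1]
  by (simp add: fps_sqrt_1_4X_def numeral_2_eq_2)

lemma fps_sqrt_1_4X_nth_0: "fps_sqrt_1_4X $ 0 = 1"
  by (simp add: sqrt_1_4X_eq[symmetric] mult.assoc)

text \<open>Squaring \<open>1 - 2xc = sqrt(1 - 4x)\<close> and cancelling \<open>4x\<close>.\<close>

lemma catalan_gf_quadratic: "catalan_gf = 1 + fps_X * catalan_gf ^ 2"
proof -
  have "(1 - 2 * fps_X * catalan_gf) ^ 2 = 1 - 4 * fps_X"
    by (simp add: sqrt_1_4X_eq fps_sqrt_1_4X_square)
  hence "4 * fps_X * catalan_gf = 4 * fps_X * (1 + fps_X * catalan_gf ^ 2)"
    by (simp add: power2_eq_square algebra_simps)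
  thus ?thesis by simp
qed

text \<open>Multiplying the quadratic equation by \<open>c^r\<close> gives
  \<open>c^(r+1) = c^r + x c^(r+2)\<close>. This expresses the case \<open>(m+1, r+1)\<close>
  through \<open>(m+1, r)\<close> and \<open>(m, r+2)\<close>, hence the induction on
  \<open>m\<close> for all \<open>r\<close> with an inner induction on \<open>r\<close>. Clearing
  the denominator \<open>2m+r\<close> also covers \<open>m = r = 0\<close>.\<close>

lemma catalan_gf_power_nth:
  "real (2 * m + r) * (catalan_gf ^ r) $ m = real r * real ((2 * m + r) choose m)"
proof (induction m arbitrary: r)
  case 0
  show ?case by (simp add: fps_power_zeroth catalan_gf_def catalan_0)
next
  case (Suc m)
  note IH_m = Suc.IH
  show ?case
  proof (induction r)
    case 0
    show ?case by simp
  next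
    case (Suc r)
    \<comment> \<open>Both smaller cases, \<open>(m+1, r)\<close> and \<open>(m, r+2)\<close>, have
      the same value \<open>N\<close> of \<open>2m+r\<close>; every binomial is reduced to
      \<open>b\<close>.\<close>
    define N where "N = 2 * m + r + 2"
    define b where "b = real (N choose m)"
    have "catalan_gf ^ Suc r = catalan_gf ^ r * (1 + fps_X * catalan_gf ^ 2)"
      unfolding catalan_gf_quadratic[symmetric] by (simp add: mult.commute)
    also have "\<dots> = catalan_gf ^ r + fps_X * catalan_gf ^ (r + 2)"
      by (simp add: power_add power2_eq_square algebra_simps)
    finally have split: "(catalan_gf ^ Suc r) $ Suc m
        = (catalan_gf ^ r) $ Suc m + (catalan_gf ^ (r + 2)) $ m"
      by (simp del: power_Suc add_2_eq_Suc')
    have "Suc m * (N choose Suc m) = (N - m) * (N choose m)"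
      using binomial_absorb_comp[of N m] binomial_absorption[of m N] by simp
    hence "real (Suc m * (N choose Suc m)) = real ((N - m) * (N choose m))"
      by (simp only:)
    hence b1: "real (Suc m) * real (N choose Suc m) = real (m + r + 2) * b"
      by (simp add: N_def b_def algebra_simps del: binomial_Suc_Suc)
    have "real (Suc m * (Suc N choose Suc m)) = real (Suc N * (N choose m))"
      by (simp only: Suc_times_binomial)
    hence b2: "real (Suc m) * real (Suc N choose Suc m) = real (Suc N) * b"
      by (simp add: b_def algebra_simps del: binomial_Suc_Suc)
    have p1: "real N * (catalan_gf ^ r) $ Suc m = real r * real (N choose Suc m)"
      using Suc.IH by (simp add: N_def del: binomial_Suc_Suc)
    have p2: "real N * (catalan_gf ^ (r + 2)) $ m = real (r + 2) * b"
      using IH_m[of "r + 2"]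
      by (simp add: N_def b_def add.assoc)
    have "real (Suc m) * (real N * (catalan_gf ^ Suc r) $ Suc m)
        = real r * (real (Suc m) * real (N choose Suc m)) + real (Suc m) * (real (r + 2) * b)"
      unfolding split distrib_left p1 p2 by (simp only: ac_simps)
    \<comment> \<open>By \<open>r(m+r+2) + (m+1)(r+2) = (r+1)N\<close>; the positive factor
      \<open>N\<close> then cancels.\<close>
    also have "\<dots> = real N * (real (Suc r) * b)"
      unfolding b1 by (simp add: N_def algebra_simps)
    finally have "real N * (real (Suc m) * (catalan_gf ^ Suc r) $ Suc m) = real N * (real (Suc r) * b)"
      by (subst mult.left_commute)
    hence "real (Suc m) * (catalan_gf ^ Suc r) $ Suc m = real (Suc r) * b"
      by (simp only: mult_cancel_left) (simp add: N_def)
    hence "real (Suc m) * (real (Suc N) * (catalan_gf ^ Suc r) $ Suc m)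
        = real (Suc m) * (real (Suc r) * real (Suc N choose Suc m))"
      unfolding mult.left_commute[of "real (Suc m)"] b2 by (simp only: mult_ac)
    hence "real (Suc N) * (catalan_gf ^ Suc r) $ Suc m
        = real (Suc r) * real (Suc N choose Suc m)"
      by (simp only: mult_cancel_left) simp
    moreover have "2 * Suc m + Suc r = Suc N" by (simp add: N_def)
    ultimately show ?case by (simp only:)
  qed
qed

text \<open>The coefficient of \<open>c^(k+1)\<close> at \<open>m = n-k\<close> is
  \<open>(k+1)/(2m+k+1)\<close> times \<open>(2m+k+1) choose m\<close>. Absorption lowers the upper
  index by one and changes the denominator to \<open>m+k+1 = n+1\<close>, the form used in
  \<open>eigen_tilde\<close>.\<close>

lemma catalan_matrix_closed_form:
  assumes "k \<le> n"
  shows "catalan_matrix n k = real ((2 * n - k) choose (n - k)) * (real (k + 1) / real (n + 1))"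
proof -
  obtain m where n: "n = k + m" using assms le_Suc_ex by blast
  define B where "B = real ((2 * m + k) choose m)"
  have "real (Suc (2 * m + k) - m) * real (Suc (2 * m + k) choose m) = real (Suc (2 * m + k)) * B"
    unfolding B_def of_nat_mult[symmetric]
    by (subst binomial_absorb_comp) simp
  hence B: "real (m + k + 1) * real (Suc (2 * m + k) choose m) = real (Suc (2 * m + k)) * B"
    by (simp add: Suc_diff_le)
  have "real (Suc (2 * m + k)) * (real (m + k + 1) * (catalan_gf ^ Suc k) $ m)
      = real (Suc k) * (real (m + k + 1) * real (Suc (2 * m + k) choose m))"
    using catalan_gf_power_nth[of m "Suc k"] by (simp del: power_Suc add: mult.left_commute)
  also have "\<dots> = real (Suc (2 * m + k)) * (real (Suc k) * B)"
    unfolding B by simp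
  finally have "real (m + k + 1) * (catalan_gf ^ Suc k) $ m = real (Suc k) * B"
    by (simp only: mult_cancel_left) simp
  moreover have "2 * n - k = 2 * m + k" by (simp add: n)
  ultimately show ?thesis
    by (simp add: catalan_matrix_nth n B_def field_simps del: power_Suc)
qed

lemma takeuchi_gf_catalan_equation:
  "takeuchi_gf = (catalan_gf - 1) / (1 - fps_X)
     + fps_X * (catalan_gf * (takeuchi_gf oo (fps_X * catalan_gf)))"
proof -
  \<comment> \<open>Adding and subtracting 2 exposes \<open>1 + x c^2\<close>, which folds back to
    \<open>c\<close>.\<close>
  have "catalan_gf * fps_sqrt_1_4X = catalan_gf - 2 * (1 + fps_X * catalan_gf ^ 2) + 2"
    unfolding sqrt_1_4X_eq[symmetric] by (simp add: power2_eq_square algebra_simps)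
  also have "\<dots> = 2 - catalan_gf"
    unfolding catalan_gf_quadratic[symmetric] by simp
  finally have "catalan_gf * fps_sqrt_1_4X = 2 - catalan_gf" .
  hence "fps_X * (2 - catalan_gf) / fps_sqrt_1_4X = fps_X * catalan_gf * fps_sqrt_1_4X / fps_sqrt_1_4X"
    by (simp add: mult.assoc)
  also have "\<dots> = fps_X * catalan_gf"
    using fps_sqrt_1_4X_nth_0 by (intro nonzero_mult_div_cancel_right) auto
  finally show ?thesis
    using takeuchi_equation_takeuchi_gf by (simp add: takeuchi_equation_def mult.assoc)
qed

text \<open>The fundamental theorem of Riordan arrays: as \<open>f\<close> has no constant term,
  \<open>f^k\<close> starts at degree \<open>k\<close> or later, so the inner sum may stop at
  \<open>n - i\<close>.\<close>

lemma riordan_apply: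
  assumes f: "f $ 0 = 0"
  shows "lt_apply (riordan g f) (fps_nth T) n = (g * (T oo f)) $ n"
proof -
  have "lt_apply (riordan g f) (fps_nth T) n
      = (\<Sum>k\<le>n. \<Sum>i\<le>n. g $ i * (T $ k * (f ^ k) $ (n - i)))"
    by (simp add: lt_apply_def riordan_def fps_mult_nth sum_distrib_left sum_distrib_right atLeast0AtMost mult_ac)
  also have "\<dots> = (\<Sum>i\<le>n. g $ i * (\<Sum>k\<le>n. T $ k * (f ^ k) $ (n - i)))"
    by (subst sum.swap) (simp add: sum_distrib_left)
  also have "\<dots> = (\<Sum>i\<le>n. g $ i * (\<Sum>k\<le>n - i. T $ k * (f ^ k) $ (n - i)))"
    using startsby_zero_power_prefix[OF f]
    by (intro sum.cong refl arg_cong2[where f = "(*)"] sum.mono_neutral_right) auto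
  also have "\<dots> = (g * (T oo f)) $ n"
    by (simp add: fps_mult_nth fps_compose_nth atLeast0AtMost)
  finally show ?thesis .
qed

text \<open>Splits off the diagonal entry; at \<open>n = 0\<close> the truncated
  \<open>n - 1\<close> is harmless because the sum is empty.\<close>

lemma eigen_matrix_apply:
  "lt_apply (eigen_matrix A) s n = s n - (\<Sum>k<n. A (n - 1) k * s k)"
proof -
  have "(\<Sum>k<n. eigen_matrix A n k * s k) = (\<Sum>k<n. - (A (n - 1) k * s k))"
    by (intro sum.cong) (auto simp: eigen_matrix_def)
  thus ?thesis
    by (simp add: lt_apply_def lessThan_Suc_atMost[symmetric] sum_negf)
       (simp add: eigen_matrix_def)
qed

text \<open>The factor \<open>x\<close> in the functional equation is the shift from row
  \<open>n - 1\<close> to row \<open>n\<close> in \<open>eigen_matrix\<close>.\<close>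

lemma eigen_matrix_takeuchi:
  "lt_apply (eigen_matrix catalan_matrix) takeuchi = fps_nth ((catalan_gf - 1) / (1 - fps_X))"
proof
  fix n
  have T: "takeuchi n = fps_nth ((catalan_gf - 1) / (1 - fps_X)) n
      + (fps_X * (catalan_gf * (takeuchi_gf oo (fps_X * catalan_gf)))) $ n"
    unfolding takeuchi_def by (subst takeuchi_gf_catalan_equation) simp
  show "lt_apply (eigen_matrix catalan_matrix) takeuchi n
      = fps_nth ((catalan_gf - 1) / (1 - fps_X)) n"
  proof (cases n)
    case 0
    thus ?thesis using T by (simp add: eigen_matrix_apply)
  next
    case (Suc m)
    have "(catalan_gf * (takeuchi_gf oo (fps_X * catalan_gf))) $ m
        = (\<Sum>k\<le>m. catalan_matrix m k * takeuchi k)"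
      using riordan_apply[of "fps_X * catalan_gf" catalan_gf takeuchi_gf m]
      by (simp add: catalan_matrix_def lt_apply_def takeuchi_def)
    thus ?thesis using T by (simp add: eigen_matrix_apply Suc lessThan_Suc_atMost)
  qed
qed

lemma lt_apply_mult:
  assumes "lower_triangular B"
  shows "lt_apply (lt_mult A B) s = lt_apply A (lt_apply B s)"
proof
  fix n
  show "lt_apply (lt_mult A B) s n = lt_apply A (lt_apply B s) n"
    \<comment> \<open>The sequence is treated as a matrix all of whose columns equal
      \<open>s\<close>.\<close>
    using fun_cong[OF fun_cong[OF lt_mult_assoc[OF assms, of A "\<lambda>i _. s i"]], of n 0]
    unfolding lt_mult_def lt_apply_def .
qed

text \<open>Column \<open>j\<close> of the right-inverse equation, solved for its entry in row
  \<open>n\<close>.\<close>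

lemma eigentriangle_rec:
  "eigentriangle A n j = (if n = j then 1 else 0) + (\<Sum>k<n. A (n - 1) k * eigentriangle A k j)"
proof -
  have "lt_mult (eigen_matrix A) (eigentriangle A) n j = lt_one n j"
    using lt_is_inverse_eigentriangle[of A] by (simp add: lt_is_inverse_def)
  moreover have "lt_mult (eigen_matrix A) (eigentriangle A) n j
      = lt_apply (eigen_matrix A) (\<lambda>i. eigentriangle A i j) n"
    by (simp add: lt_mult_def lt_apply_def)
  ultimately show ?thesis by (simp add: eigen_matrix_apply lt_one_def)
qed

lemma eigentriangle_lower: "n < j \<Longrightarrow> eigentriangle A n j = 0"
  using lt_is_inverse_eigentriangle[of A] by (simp add: lt_is_inverse_def lower_triangular_def)

text \<open>Here \<open>m\<close> is the distance below the diagonal in column \<open>j\<close>;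
  both sides then obey the same recursion.\<close>

lemma eigentriangle_eq_eigen_tilde: "eigentriangle catalan_matrix (m + j) j = eigen_tilde m j"
proof (induction m rule: less_induct)
  case (less m)
  show ?case
  proof (cases "m = 0")
    case True
    have "(\<Sum>k<j. catalan_matrix (j - 1) k * eigentriangle catalan_matrix k j) = 0"
      by (intro sum.neutral) (simp add: eigentriangle_lower)
    thus ?thesis
      using True by (simp add: eigentriangle_rec[of _ j j] eigen_tilde.simps[of 0])
  next
    case False
    let ?f = "\<lambda>k. catalan_matrix (m + j - 1) k * eigentriangle catalan_matrix k j"
    have "eigentriangle catalan_matrix (m + j) j = sum ?f {..<m + j}"
      using False by (subst eigentriangle_rec) simp
    \<comment> \<open>Entries above the diagonal vanish, so the sum starts at \<open>j\<close> and
      can be reindexed by \<open>k = i + j\<close>.\<close>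
    also have "\<dots> = sum ?f {0 + j..<m + j}"
      by (intro sum.mono_neutral_right) (auto simp: eigentriangle_lower)
    also have "\<dots> = (\<Sum>i<m. ?f (i + j))"
      unfolding lessThan_atLeast0 by (rule sum.shift_bounds_nat_ivl)
    also have "\<dots> = (\<Sum>i<m. real ((2 * (m - 1) + j - i) choose (m - 1 - i))
                    * (real (i + j + 1) / real (m + j)) * eigen_tilde i j)"
    proof (intro sum.cong refl)
      fix i assume "i \<in> {..<m}"
      hence i: "i < m" by simp
      have "catalan_matrix (m + j - 1) (i + j)
          = real ((2 * (m - 1) + j - i) choose (m - 1 - i)) * (real (i + j + 1) / real (m + j))"
      proof -
        have "2 * (m + j - 1) - (i + j) = 2 * (m - 1) + j - i" "m + j - 1 - (i + j) = m - 1 - i"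
          "m + j - 1 + 1 = m + j"
          using i by auto
        thus ?thesis using i by (simp only: catalan_matrix_closed_form)
      qed
      thus "?f (i + j) = real ((2 * (m - 1) + j - i) choose (m - 1 - i))
                    * (real (i + j + 1) / real (m + j)) * eigen_tilde i j"
        by (simp only: less[OF i])
    qed
    also have "\<dots> = eigen_tilde m j"
      using False by (simp add: eigen_tilde.simps[of m])
    finally show ?thesis .
  qed
qed

text \<open>Division by \<open>1 - x\<close> forms partial sums; \<open>C_0 = 1\<close> makes the
  constant term of \<open>c - 1\<close> vanish, which shifts the index by one.\<close>

lemma catalan_partial_sums_gf:
  "fps_nth ((catalan_gf - 1) / (1 - fps_X)) n = (\<Sum>j<n. catalan (j + 1))"
proof -
  have "fps_nth ((catalan_gf - 1) / (1 - fps_X)) n = (\<Sum>i\<le>n. (catalan_gf - 1) $ i)"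
    by (simp add: fps_divide_fps_X_minus1_sum atLeast0AtMost)
  also have "\<dots> = (\<Sum>j<n. catalan (j + 1))"
    by (simp add: sum.atMost_shift catalan_gf_def catalan_0)
  finally show ?thesis .
qed

theorem mainTheorem6:
  shows "(\<forall>n. fps_nth ((catalan_gf - 1) / (1 - fps_X)) n = (\<Sum>j<n. catalan (j + 1)))
    \<and> takeuchi = lt_apply (eigentriangle catalan_matrix) (fps_nth ((catalan_gf - 1) / (1 - fps_X)))
    \<and> (\<forall>n. takeuchi n = (\<Sum>k=0..n. eigentriangle catalan_matrix n k * (\<Sum>j<k. catalan (j + 1))))
    \<and> (\<forall>n. takeuchi n = (\<Sum>k=0..n. eigen_tilde (n - k) k * (\<Sum>j<k. catalan (j + 1))))"
proof (intro conjI allI)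
  let ?E = "eigentriangle catalan_matrix" and ?M = "eigen_matrix catalan_matrix"
  let ?g = "fps_nth ((catalan_gf - 1) / (1 - fps_X))"
  have "lower_triangular ?M"
    by (auto simp: lower_triangular_def eigen_matrix_def)
  \<comment> \<open>\<open>?E\<close> is applied to \<open>?M t = g\<close>, where \<open>t\<close>
    is \<open>takeuchi\<close>; since \<open>?E\<close> is also a left inverse, \<open>t\<close>
    remains.\<close>
  hence "lt_apply ?E ?g = lt_apply (lt_mult ?E ?M) takeuchi"
    by (simp add: lt_apply_mult eigen_matrix_takeuchi)
  also have "\<dots> = lt_apply lt_one takeuchi"
    using lt_is_inverse_eigentriangle[of catalan_matrix] by (simp add: lt_is_inverse_def)
  also have "\<dots> = takeuchi"
    using lt_mult_one_left[of "\<lambda>i _. takeuchi i"] by (simp add: lt_apply_def lt_mult_def fun_eq_iff)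
  finally show image: "takeuchi = lt_apply ?E ?g" ..
  show *: "takeuchi n = (\<Sum>k=0..n. ?E n k * (\<Sum>j<k. catalan (j + 1)))" for n
    by (subst image) (simp only: lt_apply_def catalan_partial_sums_gf atLeast0AtMost)
  have "?E n k = eigen_tilde (n - k) k" if "k \<le> n" for n k
    using eigentriangle_eq_eigen_tilde[of "n - k" k] that by simp
  thus "takeuchi n = (\<Sum>k=0..n. eigen_tilde (n - k) k * (\<Sum>j<k. catalan (j + 1)))" for n
    by (subst *) (intro sum.cong refl, simp)
qed (rule catalan_partial_sums_gf)

end
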